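(* For each $n\ge 2$, the involution monoid $(\mathsf{styl}_n,{}^* )$ satisfies the identity $x^*x^{n-1}\approx x^*x^{n}$, while $(U_{n+1}(\mathbb{T}),{}^\star)$ does not.
   Context: $\mathcal{A}_n=\{1<2<\cdots<n\}$. The stylic monoid of rank $n$, $\mathsf{styl}_n$, is the monoid presented by generators $\mathcal{A}_n$ and relations $acb=cab$ (for $a\le b<c$), $bac=bca$ (for $a<b\le c$), and $a^2=a$ (for $a\in\mathcal{A}_n$). An involution on a monoid is a unary operation $^*$ with $(x^* )^*=x$ and $(xy)^*=y^*x^*$. The involution $^*$ on $\mathsf{styl}_n$ is the anti-automorphism induced by the order-reversing permutation $x\mapsto n+1-x$ of $\mathcal{A}_n$. $\mathbb{T}=(\mathbb{R}\cup\{-\infty\},\max,+)$ is the tropical semifield (zero $-\infty$, one $0$), and $U_{n+1}(\mathbb{T})$ is the monoid, under tropical matrix multiplication, of $(n+1)\times(n+1)$ upper unitriangular matrices over $\mathbb{T}$ (entries below the diagonal $-\infty$, diagonal entries $0$). The involution $^\star$ on $U_{n+1}(\mathbb{T})$ is skew transposition (reflection in the anti-diagonal): $(X^\star)_{i,j}=X_{n+2-j,\,n+2-i}$. An involution monoid satisfies an identity $u\approx v$ (of terms in the monoid operations and the involution) if both sides agree under every evaluation of the variables. *)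

theory Defs
  imports "HOL-Algebra.Group" "Jordan_Normal_Form.Matrix"
begin

section \<open>Involution monoids and their identities\<close>

record 'a inv_monoid = "'a monoid" +
  star :: "'a \<Rightarrow> 'a"

locale involution_monoid = monoid M for M :: "('a, 'b) inv_monoid_scheme" (structure) +
  assumes star_closed: "x \<in> carrier M \<Longrightarrow> star M x \<in> carrier M"
    and star_star: "x \<in> carrier M \<Longrightarrow> star M (star M x) = x"
    and star_mult: "\<lbrakk>x \<in> carrier M; y \<in> carrier M\<rbrakk>
      \<Longrightarrow> star M (x \<otimes> y) = star M y \<otimes> star M x"

datatype 'v iterm = TVar 'v | TOne | TMult "'v iterm" "'v iterm" | TStar "'v iterm"

primrec TPow :: "'v iterm \<Rightarrow> nat \<Rightarrow> 'v iterm" where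
  "TPow t 0 = TOne"
| "TPow t (Suc k) = TMult (TPow t k) t"

primrec eval_iterm :: "('a, 'b) inv_monoid_scheme \<Rightarrow> ('v \<Rightarrow> 'a) \<Rightarrow> 'v iterm \<Rightarrow> 'a" where
  "eval_iterm M \<phi> (TVar x) = \<phi> x"
| "eval_iterm M \<phi> TOne = \<one>\<^bsub>M\<^esub>"
| "eval_iterm M \<phi> (TMult s t) = eval_iterm M \<phi> s \<otimes>\<^bsub>M\<^esub> eval_iterm M \<phi> t"
| "eval_iterm M \<phi> (TStar t) = star M (eval_iterm M \<phi> t)"

definition satisfies_identity ::
    "('a, 'b) inv_monoid_scheme \<Rightarrow> 'v iterm \<Rightarrow> 'v iterm \<Rightarrow> bool" where
  "satisfies_identity M u v \<longleftrightarrow>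
    (\<forall>\<phi>. (\<forall>x. \<phi> x \<in> carrier M) \<longrightarrow> eval_iterm M \<phi> u = eval_iterm M \<phi> v)"


section \<open>Monoid presentations\<close>

text \<open>The congruence on the free monoid \<^term>\<open>lists A\<close> generated by a set \<open>R\<close> of pairs of words.\<close>

inductive_set pres_cong :: "'a set \<Rightarrow> ('a list \<times> 'a list) set \<Rightarrow> ('a list \<times> 'a list) set"
  for A R where
  refl: "w \<in> lists A \<Longrightarrow> (w, w) \<in> pres_cong A R"
| sym: "(u, v) \<in> pres_cong A R \<Longrightarrow> (v, u) \<in> pres_cong A R"
| trans: "\<lbrakk>(u, v) \<in> pres_cong A R; (v, w) \<in> pres_cong A R\<rbrakk> \<Longrightarrow> (u, w) \<in> pres_cong A R"
| rel: "\<lbrakk>(u, v) \<in> R; u \<in> lists A; v \<in> lists A; p \<in> lists A; q \<in> lists A\<rbrakk>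
    \<Longrightarrow> (p @ u @ q, p @ v @ q) \<in> pres_cong A R"

lemma pres_cong_lists: "(u, v) \<in> pres_cong A R \<Longrightarrow> u \<in> lists A \<and> v \<in> lists A"
  by (induction rule: pres_cong.induct) auto

lemma equiv_pres_cong: "equiv (lists A) (pres_cong A R)"
proof (rule equivI)
  show "pres_cong A R \<subseteq> lists A \<times> lists A"
    using pres_cong_lists by fastforce
  show "refl_on (lists A) (pres_cong A R)"
    by (intro refl_onI pres_cong.refl)
  show "sym (pres_cong A R)"
    by (rule symI) (rule pres_cong.sym)
  show "Relation.trans (pres_cong A R)"
    by (rule transI) (rule pres_cong.trans)
qed

lemma pres_cong_context:
  assumes "(u, v) \<in> pres_cong A R" "p \<in> lists A" "q \<in> lists A"
  shows "(p @ u @ q, p @ v @ q) \<in> pres_cong A R"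
  using assms(1)
proof induction
  case (refl w)
  then show ?case using assms by (intro pres_cong.refl) auto
next
  case (sym u v)
  show ?case by (rule pres_cong.sym) (rule sym.IH)
next
  case (trans u v w)
  show ?case by (rule pres_cong.trans) (rule trans.IH)+
next
  case (rel u v p' q')
  then have "((p @ p') @ u @ (q' @ q), (p @ p') @ v @ (q' @ q)) \<in> pres_cong A R"
    using assms by (intro pres_cong.rel) auto
  then show ?case by simp
qed

lemma pres_cong_append:
  assumes "(u, u') \<in> pres_cong A R" "(v, v') \<in> pres_cong A R"
  shows "(u @ v, u' @ v') \<in> pres_cong A R"
proof -
  have "(u @ v, u' @ v) \<in> pres_cong A R"
    using pres_cong_context[OF assms(1), of "[]" v] pres_cong_lists[OF assms(2)] by simp
  moreover have "(u' @ v, u' @ v') \<in> pres_cong A R"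
    using pres_cong_context[OF assms(2), of u' "[]"] pres_cong_lists[OF assms(1)] by simp
  ultimately show ?thesis by (rule pres_cong.trans)
qed


section \<open>The stylic monoid\<close>

definition styl_rels :: "nat \<Rightarrow> (nat list \<times> nat list) set" where
  "styl_rels n =
     {([a, c, b], [c, a, b]) | a b c. a \<in> {1..n} \<and> b \<in> {1..n} \<and> c \<in> {1..n} \<and> a \<le> b \<and> b < c}
   \<union> {([b, a, c], [b, c, a]) | a b c. a \<in> {1..n} \<and> b \<in> {1..n} \<and> c \<in> {1..n} \<and> a < b \<and> b \<le> c}
   \<union> {([a, a], [a]) | a. a \<in> {1..n}}"

abbreviation styl_cong :: "nat \<Rightarrow> (nat list \<times> nat list) set" where
  "styl_cong n \<equiv> pres_cong {1..n} (styl_rels n)"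

definition flip_word :: "nat \<Rightarrow> nat list \<Rightarrow> nat list" where
  "flip_word n w = rev (map (\<lambda>a. n + 1 - a) w)"

text \<open>Elements are congruence classes of words; the operations act on representatives.\<close>

definition styl :: "nat \<Rightarrow> nat list set inv_monoid" where
  "styl n = \<lparr>carrier = lists {1..n} // styl_cong n,
     monoid.mult = (\<lambda>X Y. \<Union>u\<in>X. \<Union>v\<in>Y. styl_cong n `` {u @ v}),
     one = styl_cong n `` {[]},
     star = (\<lambda>X. \<Union>u\<in>X. styl_cong n `` {flip_word n u})\<rparr>"

lemma flip_word_lists: "w \<in> lists {1..n} \<Longrightarrow> flip_word n w \<in> lists {1..n}"
  by (fastforce simp: flip_word_def)

lemma flip_word_append: "flip_word n (u @ v) = flip_word n v @ flip_word n u"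
  by (simp add: flip_word_def)

lemma flip_word_flip_word: "w \<in> lists {1..n} \<Longrightarrow> flip_word n (flip_word n w) = w"
  by (induction w) (auto simp: flip_word_def)

lemma styl_rels_flip:
  assumes "(u, v) \<in> styl_rels n"
  shows "(flip_word n u, flip_word n v) \<in> styl_rels n"
proof -
  consider
      (1) a b c where "u = [a, c, b]" "v = [c, a, b]" "a \<in> {1..n}" "b \<in> {1..n}" "c \<in> {1..n}"
        "a \<le> b" "b < c"
    | (2) a b c where "u = [b, a, c]" "v = [b, c, a]" "a \<in> {1..n}" "b \<in> {1..n}" "c \<in> {1..n}"
        "a < b" "b \<le> c"
    | (3) a where "u = [a, a]" "v = [a]" "a \<in> {1..n}"
    using assms unfolding styl_rels_def by blast
  then show ?thesis
  proof cases
    case 1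
    then have "n + 1 - a \<in> {1..n}" "n + 1 - b \<in> {1..n}" "n + 1 - c \<in> {1..n}"
      "n + 1 - c < n + 1 - b" "n + 1 - b \<le> n + 1 - a" by auto
    then show ?thesis unfolding 1(1,2) flip_word_def styl_rels_def list.map rev.simps append.simps
      by blast
  next
    case 2
    then have "n + 1 - a \<in> {1..n}" "n + 1 - b \<in> {1..n}" "n + 1 - c \<in> {1..n}"
      "n + 1 - c \<le> n + 1 - b" "n + 1 - b < n + 1 - a" by auto
    then show ?thesis unfolding 2(1,2) flip_word_def styl_rels_def list.map rev.simps append.simps
      by blast
  next
    case 3
    then have "n + 1 - a \<in> {1..n}" by auto
    then show ?thesis unfolding 3(1,2) flip_word_def styl_rels_def list.map rev.simps append.simps
      by blast
  qed
qed

lemma styl_cong_flip: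
  "(u, v) \<in> styl_cong n \<Longrightarrow> (flip_word n u, flip_word n v) \<in> styl_cong n"
proof (induction rule: pres_cong.induct)
  case (refl w)
  then show ?case by (intro pres_cong.refl flip_word_lists)
next
  case (sym u v)
  show ?case by (rule pres_cong.sym) (rule sym.IH)
next
  case (trans u v w)
  show ?case by (rule pres_cong.trans) (rule trans.IH)+
next
  case (rel u v p q)
  have L: "flip_word n u \<in> lists {1..n}" "flip_word n v \<in> lists {1..n}"
      "flip_word n p \<in> lists {1..n}" "flip_word n q \<in> lists {1..n}"
    by (rule flip_word_lists, fact)+
  have E: "flip_word n (p @ w @ q) = flip_word n q @ flip_word n w @ flip_word n p" for w
    by (simp add: flip_word_append)
  show ?case
    unfolding E by (rule pres_cong.rel) (rule styl_rels_flip L rel(1))+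
qed

lemma styl_mult_class:
  assumes "u \<in> lists {1..n}" "v \<in> lists {1..n}"
  shows "styl_cong n `` {u} \<otimes>\<^bsub>styl n\<^esub> styl_cong n `` {v} = styl_cong n `` {u @ v}"
proof -
  have "(\<lambda>u v. styl_cong n `` {u @ v}) respects2 styl_cong n"
    by (intro congruent2I' equiv_class_eq[OF equiv_pres_cong] pres_cong_append)
  from UN_equiv_class2[OF equiv_pres_cong equiv_pres_cong this assms]
  show ?thesis by (simp add: styl_def)
qed

lemma styl_star_class:
  assumes "u \<in> lists {1..n}"
  shows "star (styl n) (styl_cong n `` {u}) = styl_cong n `` {flip_word n u}"
proof -
  have "(\<lambda>u. styl_cong n `` {flip_word n u}) respects styl_cong n"
    by (intro congruentI equiv_class_eq[OF equiv_pres_cong] styl_cong_flip)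
  from UN_equiv_class[OF equiv_pres_cong this assms]
  show ?thesis by (simp add: styl_def)
qed

lemma styl_carrier: "carrier (styl n) = (\<lambda>u. styl_cong n `` {u}) ` lists {1..n}"
  by (auto simp: styl_def quotient_def)

lemma styl_one: "\<one>\<^bsub>styl n\<^esub> = styl_cong n `` {[]}"
  by (simp add: styl_def)

lemma involution_monoid_styl: "involution_monoid (styl n)"
proof (unfold_locales)
  fix x y z
  assume x: "x \<in> carrier (styl n)" and y: "y \<in> carrier (styl n)" and z: "z \<in> carrier (styl n)"
  obtain u v w where uvw: "u \<in> lists {1..n}" "v \<in> lists {1..n}" "w \<in> lists {1..n}"
    "x = styl_cong n `` {u}" "y = styl_cong n `` {v}" "z = styl_cong n `` {w}"
    using x y z unfolding styl_carrier by blast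
  have L: "u @ v \<in> lists {1..n}" "v @ w \<in> lists {1..n}"
    using uvw by auto
  show "x \<otimes>\<^bsub>styl n\<^esub> y \<otimes>\<^bsub>styl n\<^esub> z = x \<otimes>\<^bsub>styl n\<^esub> (y \<otimes>\<^bsub>styl n\<^esub> z)"
    unfolding uvw(4-6) by (simp only: styl_mult_class uvw(1-3) L append_assoc)
next
  fix x y
  assume x: "x \<in> carrier (styl n)" and y: "y \<in> carrier (styl n)"
  obtain u v where uv: "u \<in> lists {1..n}" "v \<in> lists {1..n}"
    "x = styl_cong n `` {u}" "y = styl_cong n `` {v}"
    using x y unfolding styl_carrier by blast
  have L: "u @ v \<in> lists {1..n}"
    using uv by auto
  show "x \<otimes>\<^bsub>styl n\<^esub> y \<in> carrier (styl n)"
    unfolding uv(3,4) styl_mult_class[OF uv(1,2)] styl_carrier using L by blast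
  show "star (styl n) (x \<otimes>\<^bsub>styl n\<^esub> y) = star (styl n) y \<otimes>\<^bsub>styl n\<^esub> star (styl n) x"
    unfolding uv(3,4)
    by (simp only: styl_mult_class styl_star_class uv(1,2) L flip_word_lists flip_word_append)
next
  show "\<one>\<^bsub>styl n\<^esub> \<in> carrier (styl n)"
    unfolding styl_one styl_carrier by blast
next
  fix x
  assume x: "x \<in> carrier (styl n)"
  obtain u where u: "u \<in> lists {1..n}" "x = styl_cong n `` {u}"
    using x unfolding styl_carrier by blast
  have N: "[] \<in> lists {1..n}" by simp
  show "\<one>\<^bsub>styl n\<^esub> \<otimes>\<^bsub>styl n\<^esub> x = x"
    unfolding u(2) styl_one by (simp only: styl_mult_class u(1) N append_Nil)
  show "x \<otimes>\<^bsub>styl n\<^esub> \<one>\<^bsub>styl n\<^esub> = x"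
    unfolding u(2) styl_one by (simp only: styl_mult_class u(1) N append_Nil2)
  show "star (styl n) x \<in> carrier (styl n)"
    unfolding u(2) styl_star_class[OF u(1)] styl_carrier using flip_word_lists[OF u(1)] by blast
  show "star (styl n) (star (styl n) x) = x"
    unfolding u(2)
    by (simp only: styl_star_class u(1) flip_word_lists flip_word_flip_word)
qed


section \<open>The tropical semifield\<close>

datatype trop = MInf | Fin real

instantiation trop :: comm_semiring_1
begin

definition zero_trop :: trop where "zero_trop = MInf"
definition one_trop :: trop where "one_trop = Fin 0"

fun plus_trop :: "trop \<Rightarrow> trop \<Rightarrow> trop" where
  "plus_trop MInf y = y"
| "plus_trop x MInf = x"
| "plus_trop (Fin a) (Fin b) = Fin (max a b)"

fun times_trop :: "trop \<Rightarrow> trop \<Rightarrow> trop" where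
  "times_trop MInf y = MInf"
| "times_trop x MInf = MInf"
| "times_trop (Fin a) (Fin b) = Fin (a + b)"

instance
proof
  fix a b c :: trop
  show "a + b + c = a + (b + c)" by (cases a; cases b; cases c) auto
  show "a + b = b + a" by (cases a; cases b) auto
  show "0 + a = a" by (simp add: zero_trop_def)
  show "a * b * c = a * (b * c)" by (cases a; cases b; cases c) auto
  show "a * b = b * a" by (cases a; cases b) auto
  show "1 * a = a" by (cases a) (auto simp: one_trop_def)
  show "(a + b) * c = a * c + b * c" by (cases a; cases b; cases c) auto
  show "0 * a = 0" by (simp add: zero_trop_def)
  show "a * 0 = 0" by (cases a) (simp_all add: zero_trop_def)
  show "(0::trop) \<noteq> 1" by (simp add: zero_trop_def one_trop_def)
qed

end

text \<open>Addition is the maximum, multiplication is the usual addition; so \<^term>\<open>0::trop\<close> is minus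
  infinity and \<^term>\<open>1::trop\<close> is the real number zero.\<close>


section \<open>Upper unitriangular tropical matrices\<close>

definition unitriangular_mats :: "nat \<Rightarrow> trop mat set" where
  "unitriangular_mats m =
    {X \<in> carrier_mat m m. upper_triangular X \<and> (\<forall>i<m. X $$ (i, i) = 1)}"

text \<open>Matrix indices start at 0 here, so reflection in the anti-diagonal sends \<open>(i, j)\<close> to
  \<open>(m - 1 - j, m - 1 - i)\<close> for \<open>m \<times> m\<close> matrices.\<close>

definition skew_transpose :: "'a mat \<Rightarrow> 'a mat" where
  "skew_transpose X = mat (dim_col X) (dim_row X)
    (\<lambda>(i, j). X $$ (dim_row X - 1 - j, dim_col X - 1 - i))"

definition U_trop :: "nat \<Rightarrow> trop mat inv_monoid" where
  "U_trop m = \<lparr>carrier = unitriangular_mats m, monoid.mult = (*), one = 1\<^sub>m m,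
     star = skew_transpose\<rparr>"

lemma unitriangular_mats_mult:
  assumes X: "X \<in> unitriangular_mats m" and Y: "Y \<in> unitriangular_mats m"
  shows "X * Y \<in> unitriangular_mats m"
proof -
  have C: "X \<in> carrier_mat m m" "Y \<in> carrier_mat m m"
    and Xu: "\<And>i j. j < i \<Longrightarrow> i < m \<Longrightarrow> X $$ (i, j) = 0"
    and Yu: "\<And>i j. j < i \<Longrightarrow> i < m \<Longrightarrow> Y $$ (i, j) = 0"
    and D: "\<And>i. i < m \<Longrightarrow> X $$ (i, i) = 1" "\<And>i. i < m \<Longrightarrow> Y $$ (i, i) = 1"
    using X Y by (auto simp: unitriangular_mats_def)
  have E: "(X * Y) $$ (i, j) = (\<Sum>k\<in>{0..<m}. X $$ (i, k) * Y $$ (k, j))"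
    if "i < m" "j < m" for i j
    using that C by (auto simp: scalar_prod_def)
  have "(X * Y) $$ (i, j) = 0" if "j < i" "i < m" for i j
  proof -
    have "X $$ (i, k) * Y $$ (k, j) = 0" if "k < m" for k
      using Xu[of k i] Yu[of j k] \<open>j < i\<close> \<open>i < m\<close> that by (cases "k < i") auto
    then show ?thesis using that by (simp add: E)
  qed
  moreover have "(X * Y) $$ (i, i) = 1" if i: "i < m" for i
  proof -
    have "X $$ (i, k) * Y $$ (k, i) = (if k = i then 1 else 0)" if "k < m" for k
      using Xu[of k i] Yu[of i k] D i that by (cases k i rule: linorder_cases) auto
    then have "(X * Y) $$ (i, i) = (\<Sum>k\<in>{0..<m}. if k = i then 1 else 0)"
      using i by (simp add: E)
    then show ?thesis using i by simp
  qed
  ultimately show ?thesis using C by (auto simp: unitriangular_mats_def)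
qed

lemma skew_transpose_mult:
  assumes C: "X \<in> carrier_mat m m" "Y \<in> carrier_mat m m"
  shows "skew_transpose (X * Y) = skew_transpose Y * skew_transpose (X :: trop mat)"
proof (rule eq_matI)
  fix i j
  assume "i < dim_row (skew_transpose Y * skew_transpose X)"
    "j < dim_col (skew_transpose Y * skew_transpose X)"
  then have i: "i < m" and j: "j < m"
    using C by (auto simp: skew_transpose_def)
  have "skew_transpose (X * Y) $$ (i, j)
      = (\<Sum>k\<in>{0..<m}. X $$ (m - 1 - j, k) * Y $$ (k, m - 1 - i))"
    using C i j by (auto simp: skew_transpose_def scalar_prod_def)
  also have "\<dots> = (\<Sum>k\<in>{0..<m}. X $$ (m - 1 - j, m - 1 - k) * Y $$ (m - 1 - k, m - 1 - i))"
    by (rule sum.reindex_bij_witness[of _ "\<lambda>k. m - 1 - k" "\<lambda>k. m - 1 - k"]) auto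
  also have "\<dots> = (skew_transpose Y * skew_transpose X) $$ (i, j)"
    using C i j by (auto simp: skew_transpose_def scalar_prod_def mult.commute intro!: sum.cong)
  finally show "skew_transpose (X * Y) $$ (i, j) = (skew_transpose Y * skew_transpose X) $$ (i, j)" .
qed (use C in \<open>auto simp: skew_transpose_def\<close>)

lemma involution_monoid_U_trop: "involution_monoid (U_trop m)"
proof (unfold_locales)
  fix x y z
  assume "x \<in> carrier (U_trop m)" "y \<in> carrier (U_trop m)" "z \<in> carrier (U_trop m)"
  then show "x \<otimes>\<^bsub>U_trop m\<^esub> y \<otimes>\<^bsub>U_trop m\<^esub> z = x \<otimes>\<^bsub>U_trop m\<^esub> (y \<otimes>\<^bsub>U_trop m\<^esub> z)"
    by (auto simp: U_trop_def unitriangular_mats_def)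
next
  fix x y
  assume xy: "x \<in> carrier (U_trop m)" "y \<in> carrier (U_trop m)"
  then show "x \<otimes>\<^bsub>U_trop m\<^esub> y \<in> carrier (U_trop m)"
    by (simp add: U_trop_def unitriangular_mats_mult)
  show "star (U_trop m) (x \<otimes>\<^bsub>U_trop m\<^esub> y) = star (U_trop m) y \<otimes>\<^bsub>U_trop m\<^esub> star (U_trop m) x"
    using xy by (auto simp: U_trop_def unitriangular_mats_def intro: skew_transpose_mult)
next
  show "\<one>\<^bsub>U_trop m\<^esub> \<in> carrier (U_trop m)"
    by (auto simp: U_trop_def unitriangular_mats_def)
next
  fix x
  assume x: "x \<in> carrier (U_trop m)"
  then show "\<one>\<^bsub>U_trop m\<^esub> \<otimes>\<^bsub>U_trop m\<^esub> x = x" "x \<otimes>\<^bsub>U_trop m\<^esub> \<one>\<^bsub>U_trop m\<^esub> = x"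
    by (auto simp: U_trop_def unitriangular_mats_def)
  show "star (U_trop m) x \<in> carrier (U_trop m)"
    using x by (auto simp: U_trop_def unitriangular_mats_def skew_transpose_def upper_triangular_def)
  show "star (U_trop m) (star (U_trop m) x) = x"
    using x by (auto simp: U_trop_def unitriangular_mats_def skew_transpose_def intro!: eq_matI)
qed

end

theory Submission
  imports Defs "HOL-Library.Sublist"
begin

text \<open>A word over a set \<open>S\<close> of letters that contains the strictly decreasing word \<open>d\<close> on \<open>S\<close> as a
  subsequence equals \<open>d\<close> in the stylic monoid: if \<open>m\<close> is the maximum of \<open>S\<close>, all occurrences of \<open>m\<close>
  can be merged into the first one, the part behind it reduces to the decreasing word on \<open>S - {m}\<close>,
  and a decreasing word absorbs its own letters from the left. If \<open>u\<close> omits some letter, then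
  \<open>u\<^sup>n\<^sup>-\<^sup>1\<close> already contains the decreasing word on its letters. Otherwise \<open>u\<^sup>*\<close> supplies the letter
  \<open>n\<close> and \<open>u\<^sup>n\<^sup>-\<^sup>1\<close> the remaining \<open>n - 1\<close> letters.

  For the tropical matrices, read entries as maximal path weights: take superdiagonal weights \<open>0\<close>,
  except for the last one, which is \<open>-1\<close>, and no longer steps. A path through \<open>X\<^sup>* X\<^sup>n\<^sup>-\<^sup>1\<close> from end
  to end has to use the step of \<open>X\<^sup>*\<close>, whose weight is \<open>-1\<close>, whereas a path through \<open>X\<^sup>* X\<^sup>n\<close> need not.\<close>

section \<open>Rewriting words in the stylic monoid\<close>

lemma styl_knuth1:
  assumes "a \<le> b" "b < c" "{a, b, c} \<subseteq> {1..n}" "p \<in> lists {1..n}" "q \<in> lists {1..n}"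
  shows "(p @ a # c # b # q, p @ c # a # b # q) \<in> styl_cong n"
proof -
  have "([a, c, b], [c, a, b]) \<in> styl_rels n"
    using assms(1-3) by (auto simp: styl_rels_def)
  from pres_cong.rel[OF this _ _ assms(4,5)] show ?thesis using assms(3) by simp
qed

lemma styl_knuth2:
  assumes "a < b" "b \<le> c" "{a, b, c} \<subseteq> {1..n}" "p \<in> lists {1..n}" "q \<in> lists {1..n}"
  shows "(p @ b # a # c # q, p @ b # c # a # q) \<in> styl_cong n"
proof -
  have "([b, a, c], [b, c, a]) \<in> styl_rels n"
    using assms(1-3) by (auto simp: styl_rels_def)
  from pres_cong.rel[OF this _ _ assms(4,5)] show ?thesis using assms(3) by simp
qed

lemma styl_idem:
  assumes "a \<in> {1..n}" "p \<in> lists {1..n}" "q \<in> lists {1..n}"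
  shows "(p @ a # a # q, p @ a # q) \<in> styl_cong n"
proof -
  have "([a, a], [a]) \<in> styl_rels n"
    using assms(1) by (auto simp: styl_rels_def)
  from pres_cong.rel[OF this _ _ assms(2,3)] show ?thesis using assms(1) by simp
qed

text \<open>If \<open>a\<close> is not the head \<open>m\<close>, the letter \<open>b\<close>
  following \<open>m\<close> satisfies a \<le> b < m. So the first relation moves \<open>a\<close>
  past \<open>m\<close>, and the tail absorbs it by induction.\<close>

lemma decreasing_absorbs_letter:
  assumes "sorted_wrt (>) d" "d \<in> lists {1..n}" "a \<in> set d"
  shows "(a # d, d) \<in> styl_cong n"
  using assms
proof (induction d)
  case (Cons m d)
  show ?case
  proof (cases "a = m")
    case True
    then show ?thesis using styl_idem[of m n "[]" d] Cons.prems by auto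
  next
    case False
    then have a: "a \<in> set d" using Cons.prems by simp
    then obtain b d' where d: "d = b # d'" by (cases d) auto
    have "a \<le> b" "b < m" using Cons.prems a d by auto
    then have "(a # m # d, m # a # d) \<in> styl_cong n"
      using styl_knuth1[of a b m n "[]" d'] Cons.prems d a by auto
    also have "(m # a # d, m # d) \<in> styl_cong n"
      using pres_cong_context[OF Cons.IH, of "[m]" "[]"] Cons.prems a by simp
    finally (pres_cong.trans) show ?thesis .
  qed
qed simp

lemma decreasing_absorbs_word:
  assumes "sorted_wrt (>) d" "d \<in> lists {1..n}" "set v \<subseteq> set d"
  shows "(v @ d, d) \<in> styl_cong n"
  using assms(3)
proof (induction v)
  case Nil
  then show ?case using assms by (auto intro: pres_cong.refl)
next
  case (Cons a v)
  have "(a # v @ d, a # d) \<in> styl_cong n"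
    using pres_cong_context[OF Cons.IH, of "[a]" "[]"] Cons.prems assms(2) by auto
  also have "(a # d, d) \<in> styl_cong n"
    using decreasing_absorbs_letter assms(1,2) Cons.prems by simp
  finally (pres_cong.trans) show ?case by simp
qed

text \<open>The induction step uses the case \<open>m = p\<close> of the induction hypothesis to create a second \<open>p\<close> in
  front of the last letter of the word.\<close>

lemma large_letter_moves_left:
  assumes "p \<le> m" "{p, m} \<subseteq> {1..n}" "v \<in> lists {1..n}" "\<forall>a\<in>set v. a < p"
  shows "(p # v @ [m], p # m # v) \<in> styl_cong n"
  using assms
proof (induction v arbitrary: m rule: rev_induct)
  case Nil
  then show ?case by (auto intro!: pres_cong.refl)
next
  case (snoc a v)
  have L: "a \<in> {1..n}" "v \<in> lists {1..n}" "p \<in> {1..n}" "m \<in> {1..n}" "a < p"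
    using snoc.prems by auto
  have "(p # v @ [p], p # p # v) \<in> styl_cong n"
    using snoc by simp
  also have "(p # p # v, p # v) \<in> styl_cong n"
    using styl_idem[of p n "[]" v] L by simp
  finally (pres_cong.trans) have dup: "(p # v @ [p], p # v) \<in> styl_cong n" .
  have "(p # v @ [a, m], p # v @ [p, a, m]) \<in> styl_cong n"
    using pres_cong_context[OF pres_cong.sym[OF dup], of "[]" "[a, m]"] L by simp
  also have "(p # v @ [p, a, m], p # v @ [p, m, a]) \<in> styl_cong n"
    using styl_knuth2[of a p m n "p # v" "[]"] L snoc.prems by simp
  also (pres_cong.trans) have "(p # v @ [p, m, a], p # v @ [m, a]) \<in> styl_cong n"
    using pres_cong_context[OF dup, of "[]" "[m, a]"] L by simp
  also (pres_cong.trans) have "(p # v @ [m, a], p # m # v @ [a]) \<in> styl_cong n"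
    using pres_cong_context[OF snoc.IH[OF snoc.prems(1,2)], of "[]" "[a]"] L snoc.prems by simp
  finally (pres_cong.trans) show ?case by simp
qed

text \<open>Reading from the left, each further \<open>m\<close> is separated from the leading one
  only by smaller letters, since earlier copies are already gone. Thus
  \<open>large_letter_moves_left\<close> with \<open>p = m\<close> brings it next to the leading
  one, where idempotency removes it.\<close>

lemma merge_max_letter:
  assumes "m \<in> {1..n}" "v \<in> lists {1..n}" "\<forall>a\<in>set v. a \<le> m"
  shows "(m # v, m # filter (\<lambda>a. a \<noteq> m) v) \<in> styl_cong n"
  using assms(2,3)
proof (induction v rule: rev_induct)
  case Nil
  then show ?case using assms(1) by (auto intro: pres_cong.refl)
next
  case (snoc a v)
  let ?v = "filter (\<lambda>a. a \<noteq> m) v"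
  have L: "a \<in> {1..n}" "v \<in> lists {1..n}" "?v \<in> lists {1..n}" "\<forall>b\<in>set ?v. b < m"
    using snoc.prems by (auto simp: le_less)
  have IH: "(m # v @ [a], m # ?v @ [a]) \<in> styl_cong n"
    using pres_cong_context[OF snoc.IH, of "[]" "[a]"] L snoc.prems by simp
  show ?case
  proof (cases "a = m")
    case True
    have "(m # ?v @ [m], m # m # ?v) \<in> styl_cong n"
      by (rule large_letter_moves_left) (use assms(1) L in auto)
    also have "(m # m # ?v, m # ?v) \<in> styl_cong n"
      using styl_idem[of m n "[]" ?v] L assms(1) by simp
    finally (pres_cong.trans) show ?thesis using IH True by (auto intro: pres_cong.trans)
  qed (use IH in simp)
qed

lemma decreasing_subseq_cong:
  assumes "sorted_wrt (>) d" "d \<in> lists {1..n}" "subseq d w" "set w \<subseteq> set d"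
  shows "(w, d) \<in> styl_cong n"
  using assms
proof (induction d arbitrary: w)
  case Nil
  then show ?case by (auto intro: pres_cong.refl)
next
  case (Cons m d)
  \<comment> \<open>This occurrence of \<open>m\<close> need not be the first: \<open>w0\<close> may
    contain \<open>m\<close> too, and is absorbed at the end.\<close>
  obtain w0 w' where w: "w = w0 @ m # w'" and d: "subseq d w'"
    using list_emb_ConsD[OF Cons.prems(3)] by auto
  let ?w = "filter (\<lambda>a. a \<noteq> m) w'"
  have L: "w0 \<in> lists {1..n}" "w' \<in> lists {1..n}" "m \<in> {1..n}" "\<forall>a\<in>set w'. a \<le> m"
    using Cons.prems w by fastforce+
  \<comment> \<open>All letters of \<open>d\<close> are below \<open>m\<close>, so deleting
    \<open>m\<close> keeps \<open>d\<close> as a subsequence and leaves only letters of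
    \<open>d\<close>, as the induction hypothesis requires.\<close>
  have fd: "filter (\<lambda>a. a \<noteq> m) d = d"
    using Cons.prems by (auto simp: filter_id_conv)
  have "subseq (filter (\<lambda>a. a \<noteq> m) d) ?w"
    using d by (rule subseq_filter)
  then have red: "(?w, d) \<in> styl_cong n"
    using Cons.prems w fd by (intro Cons.IH) auto
  have "(w0 @ m # w', w0 @ m # ?w) \<in> styl_cong n"
    using pres_cong_context[OF merge_max_letter, of m n w' w0 "[]"] L by simp
  also have "(w0 @ m # ?w, w0 @ m # d) \<in> styl_cong n"
    using pres_cong_context[OF red, of "w0 @ [m]" "[]"] L by simp
  also (pres_cong.trans) have "(w0 @ m # d, m # d) \<in> styl_cong n"
    by (rule decreasing_absorbs_word) (use Cons.prems w in auto)
  finally (pres_cong.trans) show ?case using w by simp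
qed

section \<open>Powers of a word and the stylic identity\<close>

lemma subseq_concat_replicate:
  assumes "set d \<subseteq> set u" "length d \<le> k"
  shows "subseq d (concat (replicate k u))"
  using assms
proof (induction d arbitrary: k)
  case (Cons a d)
  then obtain k' where k: "k = Suc k'" by (cases k) auto
  have "subseq [a] u" using Cons.prems by (simp add: subseq_singleton_left)
  moreover have "subseq d (concat (replicate k' u))" using Cons k by simp
  ultimately have "subseq ([a] @ d) (u @ concat (replicate k' u))"
    by (rule list_emb_append_mono)
  then show ?case using k by simp
qed simp

text \<open>Since the decreasing word does not depend on \<open>k\<close>, all powers of
  \<open>u\<close> with exponent at least the number of its distinct letters agree.\<close>

lemma power_eq_decreasing:
  assumes "u \<in> lists {1..n}" "card (set u) \<le> k"
  shows "(concat (replicate k u), rev (sorted_list_of_set (set u))) \<in> styl_cong n"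
proof (rule decreasing_subseq_cong)
  show "sorted_wrt (>) (rev (sorted_list_of_set (set u)))"
    by (simp add: sorted_wrt_rev)
  show "subseq (rev (sorted_list_of_set (set u))) (concat (replicate k u))"
    using assms(2) by (intro subseq_concat_replicate) simp_all
qed (use assms(1) in auto)

lemma flip_power_eq_decreasing:
  assumes "n \<ge> 2" "set u = {1..n}" "k \<ge> n - 1"
  shows "(flip_word n u @ concat (replicate k u), rev [1..<Suc n]) \<in> styl_cong n"
proof (rule decreasing_subseq_cong)
  show "sorted_wrt (>) (rev [1..<Suc n])"
    by (simp add: sorted_wrt_rev del: upt_Suc)
  \<comment> \<open>The flip turns \<open>1\<close> into \<open>n\<close>, so the copies of
    \<open>u\<close> have to supply only the \<open>n - 1\<close> letters below
    \<open>n\<close>.\<close>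
  have "1 \<in> set u" using assms by simp
  then have "n \<in> set (flip_word n u)" by (force simp: flip_word_def)
  then have "subseq [n] (flip_word n u)" by (simp add: subseq_singleton_left)
  moreover have "subseq (rev [1..<n]) (concat (replicate k u))"
    by (rule subseq_concat_replicate) (use assms in \<open>simp_all add: subset_iff\<close>)
  ultimately have "subseq ([n] @ rev [1..<n]) (flip_word n u @ concat (replicate k u))"
    by (rule list_emb_append_mono)
  then show "subseq (rev [1..<Suc n]) (flip_word n u @ concat (replicate k u))"
    using assms(1) by simp
  have "set (flip_word n u) \<subseteq> {1..n}"
    using flip_word_lists[of u n] assms(2) by (simp add: lists_eq_set)
  moreover have "set (concat (replicate k u)) \<subseteq> {1..n}"
    using assms(2) by simp
  ultimately show "set (flip_word n u @ concat (replicate k u)) \<subseteq> set (rev [1..<Suc n])"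
    by (simp add: atLeastLessThanSuc_atLeastAtMost del: upt_Suc)
qed auto

lemma flip_power_cong:
  assumes "n \<ge> 2" "u \<in> lists {1..n}"
  shows "(flip_word n u @ concat (replicate (n - 1) u), flip_word n u @ concat (replicate n u))
    \<in> styl_cong n"
proof (cases "set u = {1..n}")
  case True
  show ?thesis
    by (rule pres_cong.trans[OF _ pres_cong.sym]; rule flip_power_eq_decreasing)
      (use assms True in auto)
next
  case False
  then have "set u \<subset> {1..n}" using assms(2) by auto
  then have "card (set u) < n" using psubset_card_mono[of "{1..n}" "set u"] by simp
  then have "(concat (replicate (n - 1) u), concat (replicate n u)) \<in> styl_cong n"
    by (intro pres_cong.trans[OF power_eq_decreasing pres_cong.sym[OF power_eq_decreasing]])
      (use assms(2) in auto)
  then show ?thesis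
    using pres_cong_context[of _ _ "{1..n}" _ "flip_word n u" "[]"] flip_word_lists[OF assms(2)]
    by simp
qed

lemma eval_TPow_styl:
  assumes "\<phi> x = styl_cong n `` {u}" "u \<in> lists {1..n}"
  shows "eval_iterm (styl n) \<phi> (TPow (TVar x) k) = styl_cong n `` {concat (replicate k u)}"
proof (induction k)
  case 0
  then show ?case by (simp add: styl_one)
next
  case (Suc k)
  have "concat (replicate k u) \<in> lists {1..n}" using assms(2) by auto
  \<comment> \<open>\<open>replicate\<close> unfolds on the left, whereas \<open>TPow\<close>
    multiplies on the right.\<close>
  moreover have "concat (replicate k u) @ u = concat (replicate (Suc k) u)"
    by (induction k) auto
  ultimately show ?case using Suc assms by (simp add: styl_mult_class del: One_nat_def)
qed

lemma styl_satisfies: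
  assumes "n \<ge> 2"
  shows "satisfies_identity (styl n)
    (TMult (TStar (TVar x)) (TPow (TVar x) (n - 1))) (TMult (TStar (TVar x)) (TPow (TVar x) n))"
  unfolding satisfies_identity_def
proof (intro allI impI)
  fix \<phi> :: "'a \<Rightarrow> nat list set"
  assume "\<forall>y. \<phi> y \<in> carrier (styl n)"
  then obtain u where u: "u \<in> lists {1..n}" "\<phi> x = styl_cong n `` {u}"
    unfolding styl_carrier by blast
  have "eval_iterm (styl n) \<phi> (TMult (TStar (TVar x)) (TPow (TVar x) k))
      = styl_cong n `` {flip_word n u @ concat (replicate k u)}" for k
  proof -
    have "concat (replicate k u) \<in> lists {1..n}" using u(1) by auto
    then show ?thesis
      using u
      by (simp add: eval_TPow_styl styl_star_class styl_mult_class flip_word_lists del: One_nat_def)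
  qed
  then show "eval_iterm (styl n) \<phi> (TMult (TStar (TVar x)) (TPow (TVar x) (n - 1)))
      = eval_iterm (styl n) \<phi> (TMult (TStar (TVar x)) (TPow (TVar x) n))"
    using equiv_class_eq[OF equiv_pres_cong flip_power_cong[OF assms u(1)]] by simp
qed

section \<open>Tropical matrices violating the identity\<close>

text \<open>Indices start at 0, so column \<open>n\<close> is the last. The skew transpose carries
  the weight -1 on the step from 0 to 1 instead.\<close>

definition path_mat :: "nat \<Rightarrow> trop mat" where
  "path_mat n = mat (n + 1) (n + 1) (\<lambda>(i, j).
     if j = i then 1 else if j = Suc i then (if j = n then Fin (- 1) else 1) else 0)"

lemma path_mat_carrier: "path_mat n \<in> carrier (U_trop (n + 1))"
  by (auto simp: path_mat_def U_trop_def unitriangular_mats_def)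

text \<open>The diagonal allows waiting for free, so paths of at most \<open>k\<close> steps count.
  Only the step into \<open>n\<close> costs anything, and a path takes it at most once.\<close>

lemma path_mat_pow:
  fixes n :: nat and x :: 'v
  defines "P \<equiv> \<lambda>k. eval_iterm (U_trop (n + 1)) (\<lambda>_. path_mat n) (TPow (TVar x) k)"
  shows "P k \<in> carrier_mat (n + 1) (n + 1) \<and> (\<forall>i\<le>n. \<forall>j\<le>n. P k $$ (i, j) =
    (if i \<le> j \<and> j \<le> i + k then (if i < j \<and> j = n then Fin (- 1) else 1) else 0))"
proof (induction k)
  case 0
  then show ?case by (auto simp: P_def U_trop_def)
next
  case (Suc k)
  let ?X = "path_mat n"
  have S: "P (Suc k) = P k * ?X" by (simp add: P_def U_trop_def)
  have X: "?X \<in> carrier_mat (n + 1) (n + 1)" by (simp add: path_mat_def)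
  have C: "P k \<in> carrier_mat (n + 1) (n + 1)" using Suc by blast
  have IH: "P k $$ (i, j) = (if i \<le> j \<and> j \<le> i + k then (if i < j \<and> j = n then Fin (- 1) else 1) else 0)"
    if "i \<le> n" "j \<le> n" for i j
    using Suc that by blast
  have "(P k * ?X) $$ (i, j) =
      (if i \<le> j \<and> j \<le> i + Suc k then (if i < j \<and> j = n then Fin (- 1) else 1) else 0)"
    if ij: "i \<le> n" "j \<le> n" for i j
  proof -
    have "(P k * ?X) $$ (i, j) = (\<Sum>l\<in>{0..<n + 1}. P k $$ (i, l) * ?X $$ (l, j))"
      using C X ij by (auto simp: scalar_prod_def)
    \<comment> \<open>For \<open>j = 0\<close> truncated subtraction makes the index set a
      singleton, hence the case split below.\<close>
    also have "\<dots> = (\<Sum>l\<in>{j - 1, j}. P k $$ (i, l) * ?X $$ (l, j))"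
      using ij by (intro sum.mono_neutral_right) (auto simp: path_mat_def)
    also have "\<dots> = (if i \<le> j \<and> j \<le> i + Suc k then (if i < j \<and> j = n then Fin (- 1) else 1) else 0)"
    proof (cases j)
      case 0
      then show ?thesis using IH[of i 0] ij by (simp add: path_mat_def)
    next
      case (Suc l)
      have "?X $$ (j, j) = 1" "?X $$ (l, j) = (if j = n then Fin (- 1) else 1)"
        using Suc ij by (auto simp: path_mat_def)
      then have "(\<Sum>l\<in>{j - 1, j}. P k $$ (i, l) * ?X $$ (l, j))
          = P k $$ (i, l) * (if j = n then Fin (- 1) else 1) + P k $$ (i, j)"
        using Suc by simp
      then show ?thesis
        using IH[of i l] IH[of i j] ij Suc
        by (cases i j rule: linorder_cases) (auto simp: one_trop_def zero_trop_def)
    qed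
    finally show ?thesis .
  qed
  then show ?case using C X unfolding S by auto
qed

text \<open>The first factor either waits at 0 or steps to 1 at cost -1. Waiting leaves
  \<open>n\<close> steps to the power and gives -1 in total; stepping leaves \<open>n - 1\<close>, a
  nonempty path as n \<ge> 2, and gives -2.\<close>

lemma skew_path_mat_pow_corner:
  assumes "n \<ge> 2"
  shows "eval_iterm (U_trop (n + 1)) (\<lambda>_. path_mat n) (TMult (TStar (TVar x)) (TPow (TVar x) k))
      $$ (0, n) = (if n \<le> k then Fin (- 1) else if n = Suc k then Fin (- 2) else 0)"
proof -
  define P where "P = eval_iterm (U_trop (n + 1)) (\<lambda>_. path_mat n) (TPow (TVar x) k)"
  let ?Y = "skew_transpose (path_mat n)"
  have P: "P \<in> carrier_mat (n + 1) (n + 1)"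
    "\<And>i. i \<le> n \<Longrightarrow> P $$ (i, n) = (if n \<le> i + k then (if i < n then Fin (- 1) else 1) else 0)"
    using path_mat_pow[of n x k] unfolding P_def by auto
  have Y: "?Y \<in> carrier_mat (n + 1) (n + 1)"
    "\<And>l. l \<le> n \<Longrightarrow> ?Y $$ (0, l) = (if l = 0 then 1 else if l = 1 then Fin (- 1) else 0)"
    using assms by (auto simp: path_mat_def skew_transpose_def)
  have "(?Y * P) $$ (0, n) = (\<Sum>l\<in>{0..<n + 1}. ?Y $$ (0, l) * P $$ (l, n))"
    using P(1) Y(1) by (auto simp: scalar_prod_def)
  also have "\<dots> = (\<Sum>l\<in>{0, 1}. ?Y $$ (0, l) * P $$ (l, n))"
    using assms by (intro sum.mono_neutral_right) (auto simp: Y(2))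
  also have "\<dots> = (if n \<le> k then Fin (- 1) else if n = Suc k then Fin (- 2) else 0)"
    using assms by (auto simp: P(2) Y(2) one_trop_def zero_trop_def)
  finally show ?thesis by (simp add: P_def U_trop_def)
qed

theorem proposition5p2:
  fixes n :: nat and x :: 'v
  assumes "n \<ge> 2"
  shows "satisfies_identity (styl n)
           (TMult (TStar (TVar x)) (TPow (TVar x) (n - 1))) (TMult (TStar (TVar x)) (TPow (TVar x) n)) \<and>
         \<not> satisfies_identity (U_trop (n + 1))
           (TMult (TStar (TVar x)) (TPow (TVar x) (n - 1))) (TMult (TStar (TVar x)) (TPow (TVar x) n))"
proof (intro conjI notI)
  assume "satisfies_identity (U_trop (n + 1))
    (TMult (TStar (TVar x)) (TPow (TVar x) (n - 1))) (TMult (TStar (TVar x)) (TPow (TVar x) n))"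
  then have "eval_iterm (U_trop (n + 1)) (\<lambda>_. path_mat n) (TMult (TStar (TVar x)) (TPow (TVar x) (n - 1)))
      = eval_iterm (U_trop (n + 1)) (\<lambda>_. path_mat n) (TMult (TStar (TVar x)) (TPow (TVar x) n))"
    using path_mat_carrier[of n] unfolding satisfies_identity_def
    by (elim allE[of _ "\<lambda>_. path_mat n"]) simp
  \<comment> \<open>The corner entry is -2 for exponent \<open>n - 1\<close> and -1 for exponent
    \<open>n\<close>.\<close>
  from arg_cong[OF this, of "\<lambda>A. A $$ (0, n)"] show False
    using assms by (simp only: skew_path_mat_pow_corner split: if_splits) auto
qed (rule styl_satisfies[OF assms])

end
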